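(* Let $\mathbf{A}\in\mathbb{R}^{n\times m}$, $\mathbf{y}\in\mathbb{N}^n$ and $\bm{\mu}_0\in\mathbb{R}^m$. For any $\mathbf{C}_0\in\mathcal{S}_m^+$, the functional $$F(\mathbf{\bar{x}},\mathbf{C}) = (\mathbf{y},\mathbf{A}\mathbf{\bar{x}})- (\mathbf{1}_n,e^{\mathbf{A}\mathbf{\bar{x}}+\frac{1}{2}\mathrm{diag}(\mathbf{A}\mathbf{C}\mathbf{A}^t)}) - \tfrac{1}{2}(\mathbf{\bar{x}}-\bm{\mu}_0)^t\mathbf{C}^{-1}_0(\mathbf{\bar{x}}-\bm{\mu}_0) - \tfrac{1}{2}\mathrm{tr}(\mathbf{C}^{-1}_0\mathbf{C})+ \tfrac{1}{2}\ln|\mathbf{C}| - \tfrac{1}{2}\ln|\mathbf{C}_0| + \tfrac{m}{2} - (\mathbf{1}_n,\ln(\mathbf{y}!))$$ is strictly jointly concave with respect to $\mathbf{\bar{x}}\in\mathbb{R}^m$ and $\mathbf{C}\in\mathcal{S}_m^+$.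
   Context: $\mathbb{N}=\{0,1,2,\ldots\}$. $\mathcal{S}_m^+$ is the (convex) set of real symmetric positive definite $m\times m$ matrices, $|\cdot|$ is the determinant, the superscript $t$ denotes transpose, and $(\cdot,\cdot)$ is the Euclidean inner product. $\mathbf{1}_n\in\mathbb{R}^n$ is the all-ones vector. Exponential, logarithm and factorial of a vector are taken componentwise. For a square matrix $\mathbf{M}$, $\mathrm{diag}(\mathbf{M})$ is the vector of its diagonal entries. For convex sets $X,Y$, a functional $f:X\times Y\to\mathbb{R}$ is jointly concave if $f(\lambda x_1+(1-\lambda)x_2,\lambda y_1+(1-\lambda)y_2)\ge\lambda f(x_1,y_1)+(1-\lambda)f(x_2,y_2)$ for all $x_1,x_2\in X$, $y_1,y_2\in Y$, $\lambda\in[0,1]$; it is strictly jointly concave if the inequality is strict whenever $(x_1,y_1)\neq(x_2,y_2)$ and $\lambda\in(0,1)$. *)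

theory Defs
  imports "HOL-Analysis.Analysis"
begin

definition pos_def_matrices :: "(real^'m^'m) set" where
  "pos_def_matrices =
     {M. transpose M = M \<and> (\<forall>x. x \<noteq> 0 \<longrightarrow> x \<bullet> (M *v x) > 0)}"

definition diag_vec :: "'a^'n^'n \<Rightarrow> 'a^'n" where
  "diag_vec M = (\<chi> i. M $ i $ i)"

definition map_vec :: "('a \<Rightarrow> 'b) \<Rightarrow> 'a^'n \<Rightarrow> 'b^'n" where
  "map_vec f v = (\<chi> i. f (v $ i))"

definition jointly_concave_on ::
  "'a::real_vector set \<Rightarrow> 'b::real_vector set \<Rightarrow> ('a \<Rightarrow> 'b \<Rightarrow> real) \<Rightarrow> bool" where
  "jointly_concave_on X Y f \<longleftrightarrow> convex X \<and> convex Y \<and>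
     (\<forall>x1\<in>X. \<forall>x2\<in>X. \<forall>y1\<in>Y. \<forall>y2\<in>Y. \<forall>l\<in>{0..1}.
        f (l *\<^sub>R x1 + (1 - l) *\<^sub>R x2) (l *\<^sub>R y1 + (1 - l) *\<^sub>R y2)
          \<ge> l * f x1 y1 + (1 - l) * f x2 y2)"

definition strictly_jointly_concave_on ::
  "'a::real_vector set \<Rightarrow> 'b::real_vector set \<Rightarrow> ('a \<Rightarrow> 'b \<Rightarrow> real) \<Rightarrow> bool" where
  "strictly_jointly_concave_on X Y f \<longleftrightarrow> jointly_concave_on X Y f \<and>
     (\<forall>x1\<in>X. \<forall>x2\<in>X. \<forall>y1\<in>Y. \<forall>y2\<in>Y. \<forall>l\<in>{0<..<1}.
        (x1, y1) \<noteq> (x2, y2) \<longrightarrow>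
        f (l *\<^sub>R x1 + (1 - l) *\<^sub>R x2) (l *\<^sub>R y1 + (1 - l) *\<^sub>R y2)
          > l * f x1 y1 + (1 - l) * f x2 y2)"

text \<open>The constant \<^term>\<open>1 :: real^'n\<close> is the all-ones vector; the size of a vector or matrix is the
  cardinality of its index type, so \<^term>\<open>A :: real^'m^'n\<close> has n rows and m columns.\<close>

definition F ::
  "real^'m^'n \<Rightarrow> nat^'n \<Rightarrow> real^'m \<Rightarrow> real^'m^'m \<Rightarrow> real^'m \<Rightarrow> real^'m^'m \<Rightarrow> real" where
  "F A y \<mu>0 C0 x C =
     map_vec real y \<bullet> (A *v x)
     - 1 \<bullet> map_vec exp (A *v x + (1/2) *\<^sub>R diag_vec (A ** C ** transpose A))
     - 1/2 * ((x - \<mu>0) \<bullet> (matrix_inv C0 *v (x - \<mu>0)))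
     - 1/2 * trace (matrix_inv C0 ** C)
     + 1/2 * ln (det C) - 1/2 * ln (det C0)
     + real CARD('m) / 2
     - 1 \<bullet> map_vec ln (map_vec (fact :: nat \<Rightarrow> real) y)"

end

theory Submission
  imports Defs
begin

text \<open>
  Everything but the log-determinant is concave by inspection: the quadratic term is strictly concave
  in x, and the other terms are affine or negative exponentials of affine maps. Strict
  concavity of \<open>ln |C|\<close> follows from the strict tangent inequality
  \<open>ln |B| < ln |M| + tr (M\<^sup>-\<^sup>1 (B - M))\<close> for \<open>B \<noteq> M\<close>, taken at the convex combination \<open>M\<close> of two
  matrices. A congruence reduces this to \<open>M = 1\<close>, i.e. \<open>ln |P| < tr P - m\<close> for \<open>P \<noteq> 1\<close>. Instead of
  the spectral theorem one uses symmetric Gaussian elimination, which preserves the determinant and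
  does not increase the trace; for a diagonal matrix the inequality is \<open>ln d \<le> d - 1\<close>.
\<close>

section \<open>Positive definite matrices: convexity and congruence\<close>

lemma pos_def_matricesD:
  assumes "M \<in> pos_def_matrices"
  shows "transpose M = M" and "x \<noteq> 0 \<Longrightarrow> x \<bullet> (M *v x) > 0"
  using assms by (auto simp: pos_def_matrices_def)

lemma inner_matrix_vector_transpose:
  fixes E :: "real^'n^'m"
  shows "x \<bullet> (E *v z) = (transpose E *v x) \<bullet> z"
  by (metis dot_lmul_matrix vector_transpose_matrix transpose_transpose)

lemma convex_pos_def_matrices: "convex (pos_def_matrices :: (real^'m^'m) set)"
proof (rule convexI)
  fix M N :: "real^'m^'m" and u v :: real
  assume M: "M \<in> pos_def_matrices" and N: "N \<in> pos_def_matrices"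
    and uv: "u \<ge> 0" "v \<ge> 0" "u + v = 1"
  have "transpose (u *\<^sub>R M + v *\<^sub>R N) = u *\<^sub>R transpose M + v *\<^sub>R transpose N"
    by (simp add: transpose_def vec_eq_iff)
  moreover have "x \<bullet> ((u *\<^sub>R M + v *\<^sub>R N) *v x) > 0" if "x \<noteq> 0" for x
  proof -
    have "x \<bullet> ((u *\<^sub>R M + v *\<^sub>R N) *v x) = u * (x \<bullet> (M *v x)) + v * (x \<bullet> (N *v x))"
      by (simp add: matrix_vector_mult_add_rdistrib scaleR_matrix_vector_assoc [symmetric]
          inner_add_right)
    moreover have "\<dots> > 0"
    proof (cases "u = 0")
      case True
      then show ?thesis using uv pos_def_matricesD(2)[OF N that] by simp
    next
      case False
      then show ?thesis
        using uv pos_def_matricesD(2)[OF M that] pos_def_matricesD(2)[OF N that]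
        by (intro add_pos_nonneg mult_pos_pos mult_nonneg_nonneg) auto
    qed
    ultimately show ?thesis by simp
  qed
  ultimately show "u *\<^sub>R M + v *\<^sub>R N \<in> pos_def_matrices"
    using pos_def_matricesD(1)[OF M] pos_def_matricesD(1)[OF N]
    by (simp add: pos_def_matrices_def)
qed

lemma matrix_vector_mult_nonzero:
  fixes E :: "real^'n^'n"
  assumes "det E \<noteq> 0" "x \<noteq> 0"
  shows "E *v x \<noteq> 0"
  using assms inj_matrix_vector_mult[of E] by (metis injD invertible_det_nz matrix_vector_mult_0_right)

lemma pos_def_congruence:
  assumes P: "P \<in> pos_def_matrices" and E: "det E \<noteq> 0"
  shows "E ** P ** transpose E \<in> pos_def_matrices"
proof -
  have "x \<bullet> (E ** P ** transpose E *v x) > 0" if "x \<noteq> 0" for x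
  proof -
    have "transpose E *v x \<noteq> 0"
      using E that by (intro matrix_vector_mult_nonzero) simp_all
    then have "(transpose E *v x) \<bullet> (P *v (transpose E *v x)) > 0"
      by (rule pos_def_matricesD(2)[OF P])
    then show ?thesis
      by (simp add: inner_matrix_vector_transpose matrix_vector_mul_assoc [symmetric])
  qed
  then show ?thesis
    using pos_def_matricesD(1)[OF P]
    by (simp add: pos_def_matrices_def matrix_transpose_mul matrix_mul_assoc)
qed

section \<open>Symmetric Gaussian elimination with positive pivots\<close>

lemma pos_def_diag_pos:
  assumes "P \<in> pos_def_matrices"
  shows "P $ k $ k > 0"
proof -
  have "axis k 1 \<bullet> (P *v axis k 1) > 0"
    by (rule pos_def_matricesD(2)[OF assms]) simp
  then show ?thesis
    by (simp add: matrix_vector_mul_component inner_axis inner_axis' matrix_vector_mult_basis column_def)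
qed

text \<open>Transposing turns the added column into a change of row \<open>k\<close> alone. Since
  \<open>c $ k = 0\<close>, the vector \<open>c\<close> lies in the span of the other unit rows, so
  adding it leaves the determinant unchanged. This covers one elimination step, with
  \<open>c\<close> as the multipliers.\<close>

lemma det_mat_plus_column:
  fixes c :: "'a::field^'n"
  assumes "c $ k = 0"
  shows "det (mat 1 + (\<chi> i j. if j = k then c $ i else 0) :: 'a^'n^'n) = 1"
proof -
  let ?I = "mat 1 :: 'a^'n^'n"
  have "c = (\<Sum>j\<in>UNIV - {k}. c $ j *s row j ?I)"
    using assms
    by (auto simp: vec_eq_iff row_def mat_def if_distrib[of "\<lambda>x. _ * x"] cong: if_cong)
  also have "\<dots> \<in> vec.span {row j ?I |j. j \<noteq> k}"
    by (intro vec.span_sum vec.span_scale vec.span_base) auto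
  finally have "det (\<chi> i. if i = k then row k ?I + c else row i ?I) = det ?I"
    by (rule det_row_span)
  also have "(\<chi> i. if i = k then row k ?I + c else row i ?I)
      = transpose (mat 1 + (\<chi> i j. if j = k then c $ i else 0))"
    by (auto simp: vec_eq_iff row_def mat_def transpose_def)
  finally show ?thesis by simp
qed

text \<open>Symmetric Gaussian elimination on the indices in \<open>K\<close>; every step that changes the matrix
  decreases the trace, because pivoting at \<open>k\<close> subtracts \<open>(P $ i $ k)\<^sup>2 / P $ k $ k\<close> from the
  diagonal entry \<open>P $ i $ i\<close>.\<close>

lemma pos_def_diagonalize_aux:
  fixes P :: "real^'n^'n"
  assumes "finite K" and "P \<in> pos_def_matrices"
    and "\<And>i j. i \<noteq> j \<Longrightarrow> i \<notin> K \<or> j \<notin> K \<Longrightarrow> P $ i $ j = 0"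
  shows "\<exists>E. det E = 1 \<and> (\<forall>i j. i \<noteq> j \<longrightarrow> (E ** P ** transpose E) $ i $ j = 0) \<and>
     (E ** P ** transpose E = P \<or> trace (E ** P ** transpose E) < trace P)"
  using assms
proof (induction K arbitrary: P rule: finite_induct)
  case empty
  then show ?case by (intro exI[of _ "mat 1"]) (simp add: transpose_mat)
next
  case (insert k K)
  have sym: "P $ i $ j = P $ j $ i" for i j
    using pos_def_matricesD(1)[OF insert.prems(1)] by (metis transpose_def vec_lambda_beta)
  have pos: "P $ k $ k > 0" by (rule pos_def_diag_pos[OF insert.prems(1)])
  \<comment> \<open>The multipliers that clear column \<open>k\<close> off the pivot. Left
    multiplication by \<open>E\<close> adds \<open>c $ i\<close> times row \<open>k\<close> to row
    \<open>i\<close>, and \<open>transpose E\<close> does the same to columns.\<close>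
  define c :: "real^'n" where "c = (\<chi> i. if i = k then 0 else - P $ i $ k / P $ k $ k)"
  define E :: "real^'n^'n" where "E = mat 1 + (\<chi> i j. if j = k then c $ i else 0)"
  define Q where "Q = E ** P ** transpose E"
  have detE: "det E = 1"
    unfolding E_def by (rule det_mat_plus_column) (simp add: c_def)
  have EP: "(E ** P) $ i $ j = P $ i $ j + c $ i * P $ k $ j" for i j
    by (simp add: E_def matrix_matrix_mult_def mat_def sum.distrib distrib_right
        if_distrib[of "\<lambda>x. x * _"] cong: if_cong)
  have Q0: "Q $ i $ j = (E ** P) $ i $ j + (E ** P) $ i $ k * c $ j" for i j
    unfolding Q_def matrix_matrix_mult_def[of "E ** P"]
    by (simp add: E_def transpose_def mat_def sum.distrib distrib_left
        if_distrib[of "\<lambda>x. _ * x"] cong: if_cong)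
  have Q: "Q $ i $ j = P $ i $ j + c $ i * P $ k $ j + (P $ i $ k + c $ i * P $ k $ k) * c $ j" for i j
    by (simp add: Q0 EP)
  have Qk: "P $ i $ k + c $ i * P $ k $ k = (if i = k then P $ k $ k else 0)" for i
    using pos by (simp add: c_def)
  have Qpd: "Q \<in> pos_def_matrices"
    unfolding Q_def by (rule pos_def_congruence[OF insert.prems(1)]) (simp add: detE)
  \<comment> \<open>For \<open>i \<noteq> k\<close> the bracket in \<open>Q\<close> vanishes by
    \<open>Qk\<close>, and symmetry gives \<open>P $ k $ i = - c $ i * P $ k $ k\<close>.\<close>
  have Qdiag: "Q $ i $ i = P $ i $ i - (c $ i)\<^sup>2 * P $ k $ k" for i
    unfolding Q Qk using pos
    by (cases "i = k") (auto simp: c_def sym[of k i] power2_eq_square field_simps)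
  have ck: "c $ k = 0" by (simp add: c_def)
  have "Q $ i $ j = 0" if "i \<noteq> j" "i \<notin> K \<or> j \<notin> K" for i j
  proof -
    consider "i = k" | "j = k" | "i \<noteq> k" "j \<noteq> k" by blast
    then show ?thesis
    proof cases
      case 1
      with that pos show ?thesis by (simp add: Q Qk ck) (simp add: c_def sym[of k j])
    next
      case 2
      with that show ?thesis using Qk[of i] by (simp add: Q ck)
    next
      case 3
      with that have *: "i \<notin> insert k K \<or> j \<notin> insert k K" by auto
      have "P $ i $ j = 0" using insert.prems(2) that(1) * by blast
      \<comment> \<open>No fill-in outside \<open>K\<close>: the correction
        \<open>c $ i * P $ k $ j\<close> needs both \<open>i\<close> and \<open>j\<close> to be
        coupled to \<open>k\<close>, but one of them lies outside \<open>insert k K\<close> and is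
        already decoupled.\<close>
      moreover have "P $ i $ k = 0 \<or> P $ k $ j = 0"
        using insert.prems(2)[of i k] insert.prems(2)[of k j] 3 * by auto
      ultimately show ?thesis using 3 by (auto simp: Q Qk c_def)
    qed
  qed
  then obtain E' where E': "det E' = 1"
    "\<forall>i j. i \<noteq> j \<longrightarrow> (E' ** Q ** transpose E') $ i $ j = 0"
    "E' ** Q ** transpose E' = Q \<or> trace (E' ** Q ** transpose E') < trace Q"
    using insert.IH[OF Qpd] by metis
  have eq: "E' ** Q ** transpose E' = (E' ** E) ** P ** transpose (E' ** E)"
    by (simp add: Q_def matrix_transpose_mul matrix_mul_assoc)
  have "Q = P \<or> trace Q < trace P"
  proof (cases "c = 0")
    case True
    then have "Q = P" by (simp add: vec_eq_iff Q)
    then show ?thesis ..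
  next
    case False
    then obtain i where "c $ i \<noteq> 0" by (auto simp: vec_eq_iff)
    then have "Q $ i $ i < P $ i $ i" using pos by (simp add: Qdiag)
    moreover have "Q $ j $ j \<le> P $ j $ j" for j using pos by (simp add: Qdiag)
    ultimately have "trace Q < trace P"
      unfolding trace_def by (intro sum_strict_mono_ex1) auto
    then show ?thesis ..
  qed
  then have "E' ** Q ** transpose E' = P \<or> trace (E' ** Q ** transpose E') < trace P"
    using E'(3) by auto
  moreover have "det (E' ** E) = 1" by (simp add: det_mul E'(1) detE)
  ultimately show ?case using E'(2) unfolding eq by blast
qed

lemma pos_def_diagonalize:
  fixes P :: "real^'n^'n"
  assumes "P \<in> pos_def_matrices"
  obtains E where "det E = 1"
    "\<And>i j. i \<noteq> j \<Longrightarrow> (E ** P ** transpose E) $ i $ j = 0"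
    "\<And>i. (E ** P ** transpose E) $ i $ i > 0"
    "E ** P ** transpose E = P \<or> trace (E ** P ** transpose E) < trace P"
proof -
  obtain E where E: "det E = 1" "\<And>i j. i \<noteq> j \<Longrightarrow> (E ** P ** transpose E) $ i $ j = 0"
    "E ** P ** transpose E = P \<or> trace (E ** P ** transpose E) < trace P"
    using pos_def_diagonalize_aux[of UNIV P] assms by auto
  have pos: "(E ** P ** transpose E) $ i $ i > 0" for i
    by (rule pos_def_diag_pos, rule pos_def_congruence[OF assms]) (simp add: E)
  show thesis by (rule that[OF E(1,2) pos E(3)])
qed

section \<open>Determinant against trace\<close>

lemma pos_def_det_pos:
  assumes "P \<in> pos_def_matrices"
  shows "det P > 0"
proof -
  obtain E where E: "det E = 1" "\<And>i j. i \<noteq> j \<Longrightarrow> (E ** P ** transpose E) $ i $ j = 0"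
    "\<And>i. (E ** P ** transpose E) $ i $ i > 0"
    using pos_def_diagonalize[OF assms] by metis
  have "det P = det (E ** P ** transpose E)" by (simp add: det_mul E(1))
  also have "\<dots> = (\<Prod>i\<in>UNIV. (E ** P ** transpose E) $ i $ i)"
    by (rule det_diagonal) (rule E(2))
  also have "\<dots> > 0" by (rule prod_pos) (simp add: E(3))
  finally show ?thesis .
qed

text \<open>Strictness has two sources. Either elimination strictly lowers the trace, or
  \<open>P\<close> was already diagonal; then some diagonal entry differs from 1, and
  \<open>ln d < d - 1\<close> there.\<close>

lemma ln_det_less_trace:
  fixes P :: "real^'n^'n"
  assumes P: "P \<in> pos_def_matrices" and ne: "P \<noteq> mat 1"
  shows "ln (det P) < trace P - real CARD('n)"
proof -
  obtain E where E: "det E = 1" "\<And>i j. i \<noteq> j \<Longrightarrow> (E ** P ** transpose E) $ i $ j = 0"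
    "\<And>i. (E ** P ** transpose E) $ i $ i > 0"
    "E ** P ** transpose E = P \<or> trace (E ** P ** transpose E) < trace P"
    using pos_def_diagonalize[OF P] by metis
  define D where "D = E ** P ** transpose E"
  note D = E(2-4)[folded D_def]
  have le: "ln (D $ i $ i) \<le> D $ i $ i - 1" for i using D(2) by (rule ln_le_minus_one)
  have "det P = det D" by (simp add: D_def det_mul E(1))
  also have "\<dots> = (\<Prod>i\<in>UNIV. D $ i $ i)" by (rule det_diagonal) (rule D(1))
  finally have lndet: "ln (det P) = (\<Sum>i\<in>UNIV. ln (D $ i $ i))"
    using D(2) by (simp add: ln_prod less_imp_neq[THEN not_sym])
  have tr: "(\<Sum>i\<in>UNIV. D $ i $ i - 1) = trace D - real CARD('n)"
    by (simp add: sum_subtractf trace_def)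
  from D(3) show ?thesis
  proof
    assume "trace D < trace P"
    moreover have "ln (det P) \<le> trace D - real CARD('n)"
      unfolding lndet tr [symmetric] by (rule sum_mono) (rule le)
    ultimately show ?thesis by simp
  next
    assume "D = P"
    have "\<exists>i. D $ i $ i \<noteq> 1"
    proof (rule ccontr)
      assume "\<nexists>i. D $ i $ i \<noteq> 1"
      then have "D = mat 1" using D(1) by (auto simp: vec_eq_iff mat_def)
      with ne \<open>D = P\<close> show False by simp
    qed
    then obtain i where "ln (D $ i $ i) < D $ i $ i - 1"
      using ln_eq_minus_one[OF D(2)] le by (metis less_eq_real_def)
    then have "ln (det P) < trace D - real CARD('n)"
      unfolding lndet tr [symmetric] using le by (intro sum_strict_mono_ex1) auto
    with \<open>D = P\<close> show ?thesis by simp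
  qed
qed

section \<open>Whitening, inverses and the tangent inequality for the log-determinant\<close>

lemma pos_def_whiten:
  fixes M :: "real^'n^'n"
  assumes M: "M \<in> pos_def_matrices"
  obtains R where "R ** M ** transpose R = mat 1" "det R \<noteq> 0"
proof -
  obtain E where E: "det E = 1" "\<And>i j. i \<noteq> j \<Longrightarrow> (E ** M ** transpose E) $ i $ j = 0"
    "\<And>i. (E ** M ** transpose E) $ i $ i > 0"
    using pos_def_diagonalize[OF M] by metis
  define D where "D = E ** M ** transpose E"
  note D = E(2,3)[folded D_def]
  \<comment> \<open>Rescaling the pivots to 1 makes \<open>S ** E\<close> a substitute for the
    inverse square root of \<open>M\<close>, although it need not be symmetric.\<close>
  define S :: "real^'n^'n" where "S = (\<chi> i j. if i = j then 1 / sqrt (D $ i $ i) else 0)"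
  have "(S ** D ** transpose S) $ i $ j = (mat 1 :: real^'n^'n) $ i $ j" for i j
  proof -
    have "(S ** D) $ i $ l = D $ i $ l / sqrt (D $ i $ i)" for l
      by (simp add: S_def matrix_matrix_mult_def if_distrib[of "\<lambda>x. x * _"] cong: if_cong)
    then have "(S ** D ** transpose S) $ i $ j = D $ i $ j / sqrt (D $ i $ i) / sqrt (D $ j $ j)"
      unfolding matrix_matrix_mult_def[of "S ** D"]
      by (simp add: S_def transpose_def if_distrib[of "\<lambda>x. _ * x"] cong: if_cong)
    then show ?thesis
      using D(1)[of i j] D(2)[of i] by (auto simp: mat_def)
  qed
  then have "S ** D ** transpose S = mat 1" by (simp add: vec_eq_iff)
  then have R: "(S ** E) ** M ** transpose (S ** E) = mat 1"
    by (simp add: D_def matrix_transpose_mul matrix_mul_assoc)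
  then have "det (S ** E) * det M * det (S ** E) = 1"
    by (metis det_I det_mul det_transpose)
  then have "det (S ** E) \<noteq> 0" by auto
  with R that show thesis by blast
qed

text \<open>\<open>matrix_inv\<close> is a choice of a two-sided inverse, so its existence must be
  shown first; for square matrices a right inverse is also a left inverse.\<close>

lemma matrix_inv_eqI:
  fixes M :: "real^'n^'n"
  assumes "M ** N = mat 1"
  shows "matrix_inv M = N"
proof -
  have "\<exists>N. M ** N = mat 1 \<and> N ** M = mat 1"
    using assms matrix_left_right_inverse by blast
  then have "matrix_inv M ** M = mat 1"
    unfolding matrix_inv_def by (rule someI2_ex) simp
  then show ?thesis
    by (metis assms matrix_mul_assoc matrix_mul_lid matrix_mul_rid)
qed

lemma whiten_inverse:
  fixes M R :: "real^'n^'n"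
  assumes "R ** M ** transpose R = mat 1"
  shows "matrix_inv M = transpose R ** R"
proof (rule matrix_inv_eqI)
  have "(M ** transpose R) ** R = mat 1"
    using assms matrix_left_right_inverse[of R "M ** transpose R"] by (simp add: matrix_mul_assoc)
  then show "M ** (transpose R ** R) = mat 1" by (simp add: matrix_mul_assoc)
qed

text \<open>Here \<open>matrix_inv M\<close> is the gradient of the log-determinant at
  \<open>M\<close>. With \<open>P = R ** B ** transpose R\<close>, the bound on
  \<open>ln (det P)\<close> translates back because
  \<open>trace P = trace (matrix_inv M ** B)\<close> and
  \<open>det P = det B / det M\<close>.\<close>

lemma ln_det_tangent:
  fixes M B :: "real^'n^'n"
  assumes M: "M \<in> pos_def_matrices" and B: "B \<in> pos_def_matrices" and ne: "B \<noteq> M"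
  shows "ln (det B) < ln (det M) + trace (matrix_inv M ** (B - M))"
proof -
  obtain R where R: "R ** M ** transpose R = mat 1" "det R \<noteq> 0"
    using pos_def_whiten[OF M] by metis
  define P where "P = R ** B ** transpose R"
  have "invertible R" "invertible (transpose R)" using R(2) by (simp_all add: invertible_det_nz)
  then obtain R1 R2 where R12: "R1 ** R = mat 1" "transpose R ** R2 = mat 1"
    unfolding invertible_def by blast
  \<comment> \<open>Both \<open>B\<close> and \<open>M\<close> would be sent to the identity by the
    same invertible congruence, hence be equal.\<close>
  have "P \<noteq> mat 1"
  proof
    assume "P = mat 1"
    then have "R1 ** (R ** B ** transpose R) ** R2 = R1 ** (R ** M ** transpose R) ** R2"
      using R(1) by (simp add: P_def)
    then have "(R1 ** R) ** B ** (transpose R ** R2) = (R1 ** R) ** M ** (transpose R ** R2)"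
      by (simp add: matrix_mul_assoc)
    with ne show False by (simp add: R12)
  qed
  then have "ln (det P) < trace P - real CARD('n)"
    unfolding P_def by (intro ln_det_less_trace pos_def_congruence B R(2))
  moreover have "trace P = trace (matrix_inv M ** B)"
    unfolding P_def whiten_inverse[OF R(1)]
    by (subst trace_mul_sym) (simp add: matrix_mul_assoc)
  moreover have "trace (matrix_inv M ** (B - M)) = trace (matrix_inv M ** B) - real CARD('n)"
  proof -
    have "trace (transpose R ** R ** M) = trace (R ** M ** transpose R)"
      by (subst (2) trace_mul_sym) (simp add: matrix_mul_assoc)
    then have "trace (matrix_inv M ** M) = real CARD('n)"
      by (simp add: whiten_inverse[OF R(1)] R(1) trace_I)
    moreover have "matrix_inv M ** (B - M) = matrix_inv M ** B - matrix_inv M ** M"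
      by (simp add: vec_eq_iff matrix_matrix_mult_def right_diff_distrib sum_subtractf)
    ultimately show ?thesis by (simp add: trace_sub)
  qed
  moreover have "ln (det P) = ln (det B) - ln (det M)"
  proof -
    \<comment> \<open>The whitening identity fixes the square of \<open>det R\<close> as the
      reciprocal of \<open>det M\<close>.\<close>
    have "det R * det M * det R = 1" using R(1) by (metis det_I det_mul det_transpose)
    then have "det P = det B / det M"
      using pos_def_det_pos[OF M] by (simp add: P_def det_mul field_simps)
    then show ?thesis
      using pos_def_det_pos[OF M] pos_def_det_pos[OF B] by (simp add: ln_div)
  qed
  ultimately show ?thesis by simp
qed

lemma trace_scaleR: "trace (c *\<^sub>R M) = c * trace (M :: real^'n^'n)"
  by (simp add: trace_def sum_distrib_left)

lemma matrix_mul_linear_comb_right: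
  fixes N :: "real^'n^'m" and P Q :: "real^'k^'n"
  shows "N ** (a *\<^sub>R P + b *\<^sub>R Q) = a *\<^sub>R (N ** P) + b *\<^sub>R (N ** Q)"
  by (simp add: vec_eq_iff matrix_matrix_mult_def sum_distrib_left sum.distrib algebra_simps)

lemma matrix_mul_linear_comb_left:
  fixes N :: "real^'k^'n" and P Q :: "real^'n^'m"
  shows "(a *\<^sub>R P + b *\<^sub>R Q) ** N = a *\<^sub>R (P ** N) + b *\<^sub>R (Q ** N)"
  by (simp add: vec_eq_iff matrix_matrix_mult_def sum_distrib_left sum.distrib distrib_right mult.assoc)

text \<open>The tangent inequalities at the intermediate point \<open>M\<close> are averaged with
  weights \<open>l\<close> and \<open>1 - l\<close>; the weighted deviations from \<open>M\<close>
  sum to zero, so the linear terms cancel.\<close>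

lemma ln_det_strictly_concave:
  fixes B1 B2 :: "real^'n^'n"
  assumes B1: "B1 \<in> pos_def_matrices" and B2: "B2 \<in> pos_def_matrices" and ne: "B1 \<noteq> B2"
    and l: "0 < l" "l < 1"
  shows "l * ln (det B1) + (1 - l) * ln (det B2) < ln (det (l *\<^sub>R B1 + (1 - l) *\<^sub>R B2))"
proof -
  define M where "M = l *\<^sub>R B1 + (1 - l) *\<^sub>R B2"
  have d: "B1 - M = (1 - l) *\<^sub>R (B1 - B2)" "B2 - M = l *\<^sub>R (B2 - B1)"
    by (simp_all add: M_def algebra_simps)
  have M: "M \<in> pos_def_matrices"
    unfolding M_def using l by (intro convexD[OF convex_pos_def_matrices] B1 B2) auto
  have "B1 \<noteq> M" "B2 \<noteq> M" using d ne l by auto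
  note t = ln_det_tangent[OF M B1 \<open>B1 \<noteq> M\<close>] ln_det_tangent[OF M B2 \<open>B2 \<noteq> M\<close>]
  have z: "l * trace (matrix_inv M ** (B1 - M)) + (1 - l) * trace (matrix_inv M ** (B2 - M)) = 0"
  proof -
    have "l *\<^sub>R (B1 - M) + (1 - l) *\<^sub>R (B2 - M) = 0" by (simp add: M_def algebra_simps)
    then have "trace (matrix_inv M ** (l *\<^sub>R (B1 - M) + (1 - l) *\<^sub>R (B2 - M))) = 0"
      by (simp add: trace_def)
    then show ?thesis by (simp add: matrix_mul_linear_comb_right trace_add trace_scaleR)
  qed
  have "l * ln (det B1) < l * (ln (det M) + trace (matrix_inv M ** (B1 - M)))"
    using t(1) l by (intro mult_strict_left_mono)
  moreover have "(1 - l) * ln (det B2) < (1 - l) * (ln (det M) + trace (matrix_inv M ** (B2 - M)))"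
    using t(2) l by (intro mult_strict_left_mono) auto
  ultimately show ?thesis using z unfolding M_def [symmetric] by (simp add: algebra_simps)
qed

section \<open>The remaining terms and the joint estimate\<close>

lemma norm_power2_convex_comb:
  fixes u v :: "'a::real_inner"
  shows "(norm (l *\<^sub>R u + (1 - l) *\<^sub>R v))\<^sup>2
    = l * (norm u)\<^sup>2 + (1 - l) * (norm v)\<^sup>2 - l * (1 - l) * (norm (u - v))\<^sup>2"
  by (simp add: power2_norm_eq_inner inner_commute algebra_simps)

lemma sum_exp_convex_comb:
  fixes u v :: "real^'n"
  assumes "0 \<le> l" "l \<le> 1"
  shows "1 \<bullet> map_vec exp (l *\<^sub>R u + (1 - l) *\<^sub>R v)
    \<le> l * (1 \<bullet> map_vec exp u) + (1 - l) * (1 \<bullet> map_vec exp v)"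
proof -
  have "exp (l * a + (1 - l) * b) \<le> l * exp a + (1 - l) * exp b" for a b :: real
    \<comment> \<open>\<open>convex_onD\<close> puts its parameter on the second point, hence
      \<open>1 - l\<close>.\<close>
    using convex_onD[OF exp_convex, of "1 - l" a b] assms by (simp add: algebra_simps)
  then show ?thesis
    by (simp add: inner_vec_def map_vec_def sum_distrib_left sum.distrib [symmetric] sum_mono)
qed

text \<open>The weak inequality follows from the strict one, since the cases left over
  (\<open>l\<close> equal to 0 or 1, or coinciding points) are equalities.\<close>

lemma strictly_jointly_concave_onI:
  assumes "convex X" "convex Y"
    and strict: "\<And>x1 x2 y1 y2 l. \<lbrakk>x1 \<in> X; x2 \<in> X; y1 \<in> Y; y2 \<in> Y; 0 < l; l < 1; (x1, y1) \<noteq> (x2, y2)\<rbrakk> \<Longrightarrow>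
      l * f x1 y1 + (1 - l) * f x2 y2 < f (l *\<^sub>R x1 + (1 - l) *\<^sub>R x2) (l *\<^sub>R y1 + (1 - l) *\<^sub>R y2)"
  shows "strictly_jointly_concave_on X Y f"
proof -
  have "l * f x1 y1 + (1 - l) * f x2 y2 \<le> f (l *\<^sub>R x1 + (1 - l) *\<^sub>R x2) (l *\<^sub>R y1 + (1 - l) *\<^sub>R y2)"
    if "x1 \<in> X" "x2 \<in> X" "y1 \<in> Y" "y2 \<in> Y" "l \<in> {0..1}" for x1 x2 y1 y2 l
  proof (cases "l = 0 \<or> l = 1 \<or> (x1, y1) = (x2, y2)")
    case True
    then show ?thesis by (auto simp: scaleR_add_left [symmetric] algebra_simps)
  next
    case False
    with that show ?thesis by (intro less_imp_le strict) auto
  qed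
  with assms show ?thesis
    by (auto simp: strictly_jointly_concave_on_def jointly_concave_on_def)
qed

theorem theorem3p1:
  fixes A :: "real^'m^'n" and y :: "nat^'n" and \<mu>0 :: "real^'m" and C0 :: "real^'m^'m"
  assumes "C0 \<in> pos_def_matrices"
  shows "strictly_jointly_concave_on (UNIV :: (real^'m) set) pos_def_matrices (F A y \<mu>0 C0)"
proof (rule strictly_jointly_concave_onI)
  fix x1 x2 :: "real^'m" and C1 C2 :: "real^'m^'m" and l :: real
  assume C: "C1 \<in> pos_def_matrices" "C2 \<in> pos_def_matrices" and l: "0 < l" "l < 1"
    and ne: "(x1, C1) \<noteq> (x2, C2)"
  define x where "x = l *\<^sub>R x1 + (1 - l) *\<^sub>R x2"
  define C where "C = l *\<^sub>R C1 + (1 - l) *\<^sub>R C2"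
  \<comment> \<open>Whitening \<open>C0\<close> turns the quadratic form of its inverse into the
    squared norm of \<open>R *v (x - \<mu>0)\<close>, to which the exact convexity defect
    applies.\<close>
  obtain R where R: "R ** C0 ** transpose R = mat 1" "det R \<noteq> 0"
    using pos_def_whiten[OF assms] by metis
  define g where "g = (\<lambda>x C. A *v x + (1/2) *\<^sub>R diag_vec (A ** C ** transpose A))"
  define q where "q = (\<lambda>x. (norm (R *v (x - \<mu>0)))\<^sup>2)"
  define T where "T = (\<lambda>C. trace (matrix_inv C0 ** C))"
  define K where "K = - 1/2 * ln (det C0) + real CARD('m) / 2
     - 1 \<bullet> map_vec ln (map_vec (fact :: nat \<Rightarrow> real) y)"
  have F: "F A y \<mu>0 C0 x C = map_vec real y \<bullet> (A *v x) - 1 \<bullet> map_vec exp (g x C)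
      - 1/2 * q x - 1/2 * T C + 1/2 * ln (det C) + K" for x C
    by (simp add: F_def g_def q_def T_def K_def whiten_inverse[OF R(1)] power2_norm_eq_inner
        matrix_vector_mul_assoc [symmetric] inner_matrix_vector_transpose inner_commute)
  have Ax: "A *v x = l *\<^sub>R (A *v x1) + (1 - l) *\<^sub>R (A *v x2)"
    by (simp add: x_def matrix_vector_right_distrib matrix_vector_mult_scaleR)
  have lin: "map_vec real y \<bullet> (A *v x)
      = l * (map_vec real y \<bullet> (A *v x1)) + (1 - l) * (map_vec real y \<bullet> (A *v x2))"
    by (simp add: Ax inner_add_right)
  have "g x C = l *\<^sub>R g x1 C1 + (1 - l) *\<^sub>R g x2 C2"
  proof -
    have ACA: "A ** C ** transpose A
        = l *\<^sub>R (A ** C1 ** transpose A) + (1 - l) *\<^sub>R (A ** C2 ** transpose A)"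
      by (simp add: C_def matrix_mul_linear_comb_right matrix_mul_linear_comb_left)
    show ?thesis
      unfolding g_def ACA Ax by (simp add: diag_vec_def vec_eq_iff field_simps)
  qed
  then have e: "1 \<bullet> map_vec exp (g x C)
      \<le> l * (1 \<bullet> map_vec exp (g x1 C1)) + (1 - l) * (1 \<bullet> map_vec exp (g x2 C2))"
    using sum_exp_convex_comb[of l "g x1 C1" "g x2 C2"] l by simp
  have tr: "T C = l * T C1 + (1 - l) * T C2"
    by (simp add: T_def C_def matrix_mul_linear_comb_right trace_add trace_scaleR)
  define r where "r = l * (1 - l) * (norm (R *v (x1 - x2)))\<^sup>2"
  have q: "q x = l * q x1 + (1 - l) * q x2 - r"
  proof -
    have "x - \<mu>0 = l *\<^sub>R (x1 - \<mu>0) + (1 - l) *\<^sub>R (x2 - \<mu>0)"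
      by (simp add: x_def algebra_simps)
    then have "R *v (x - \<mu>0) = l *\<^sub>R (R *v (x1 - \<mu>0)) + (1 - l) *\<^sub>R (R *v (x2 - \<mu>0))"
      by (simp add: matrix_vector_right_distrib matrix_vector_mult_scaleR)
    moreover have "R *v (x1 - \<mu>0) - R *v (x2 - \<mu>0) = R *v (x1 - x2)"
      by (simp add: matrix_vector_mult_diff_distrib)
    ultimately show ?thesis by (simp add: q_def r_def norm_power2_convex_comb)
  qed
  have d: "l * ln (det C1) + (1 - l) * ln (det C2) < ln (det C)" if "C1 \<noteq> C2"
    unfolding C_def by (rule ln_det_strictly_concave[OF C that l])
  have d': "l * ln (det C1) + (1 - l) * ln (det C2) = ln (det C)" if "C1 = C2"
    using that by (simp add: C_def algebra_simps)
  have n: "0 < r" if "x1 \<noteq> x2"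
  proof -
    have "R *v (x1 - x2) \<noteq> 0"
      using R(2) that by (intro matrix_vector_mult_nonzero) simp_all
    with l show ?thesis by (simp add: r_def)
  qed
  have n': "0 \<le> r" using l by (simp add: r_def)
  \<comment> \<open>Only these two terms supply strictness: the log-determinant when
    \<open>C1 \<noteq> C2\<close>, and otherwise the quadratic defect \<open>r\<close>, as then
    \<open>x1 \<noteq> x2\<close>.\<close>
  have "- 1/2 * (l * q x1 + (1 - l) * q x2) + 1/2 * (l * ln (det C1) + (1 - l) * ln (det C2))
      < - 1/2 * q x + 1/2 * ln (det C)"
  proof (cases "C1 = C2")
    case True
    with ne have "x1 \<noteq> x2" by simp
    then have "0 < r" by (rule n)
    with q d'[OF True] show ?thesis by argo
  next
    case False
    from q d[OF this] n' show ?thesis by argo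
  qed
  then show "l * F A y \<mu>0 C0 x1 C1 + (1 - l) * F A y \<mu>0 C0 x2 C2
      < F A y \<mu>0 C0 (l *\<^sub>R x1 + (1 - l) *\<^sub>R x2) (l *\<^sub>R C1 + (1 - l) *\<^sub>R C2)"
    unfolding x_def [symmetric] C_def [symmetric] F using lin e tr by (simp add: field_simps)
qed (simp_all add: convex_pos_def_matrices)

end
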